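(* Let $\mathcal{L}\subset\operatorname{Lip}_1(\mathbb{R})$ be a monoidal family with $\mathcal{T}\subset\mathcal{L}$. For any mm-space $X$ and any $\kappa\in(0,1)$, $$\operatorname{ObsDiam}(\mathcal{D}^{\mathcal{L}}_\circ(X);-\kappa)=\operatorname{ObsDiam}(X_\circ;-\kappa).$$
   Context: An mm-space is a triple $(X,d_X,\mu_X)$ with $(X,d_X)$ a complete separable metric space and $\mu_X$ a Borel probability measure with full support. $\operatorname{Lip}_1(\mathbb{R})$ is the set of 1-Lipschitz functions $\mathbb{R}\to\mathbb{R}$; $\mathcal{L}\subset\operatorname{Lip}_1(\mathbb{R})$ is monoidal if it contains $\mathrm{id}_{\mathbb{R}}$ and is closed under composition and under pointwise convergence on $\mathbb{R}$; $\mathcal{T}:=\{x\mapsto x+c:c\in\mathbb{R}\}$. A geometric data set is a triple $(X,F_X,\mu_X)$ where $F_X$ is a nonempty set of real-valued functions on $X$ such that $\sup_{f\in F_X}|f(x)-f(y)|$ is a complete separable metric on $X$, and $\mu_X$ is a Borel probability measure with full support for this metric. For an mm-space $X$, put $X_\circ:=(X,\{x\mapsto d_X(x,y): y\in X\},\mu_X)$ and $\mathcal{D}^{\mathcal{L}}_\circ(X):=(X,\{x\mapsto p(d_X(x,y)): p\in\mathcal{L},\ y\in X\},\mu_X)$; both are geometric data sets. For a Borel probability measure $\mu$ on $\mathbb{R}$, $\operatorname{PartDiam}(\mu;1-\kappa):=\inf\{\operatorname{diam} I: I\subset\mathbb{R}\text{ Borel},\ \mu(I)\ge1-\kappa\}$;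 for a geometric data set $X$, $\operatorname{ObsDiam}(X;-\kappa):=\sup_{f\in F_X}\operatorname{PartDiam}(f_*\mu_X;1-\kappa)$. *)

theory Defs
  imports "HOL-Analysis.Analysis" "HOL-Probability.Probability"
begin

text \<open>Values of \<open>d\<close> outside the carrier are irrelevant, except that \<^locale>\<open>Metric_space\<close>
  wants them nonnegative and symmetric.\<close>

locale mm_space = Metric_space X d + prob_space \<mu>
  for X :: "'a set" and d :: "'a \<Rightarrow> 'a \<Rightarrow> real" and \<mu> :: "'a measure" +
  assumes complete: "mcomplete"
    and separable: "separable_space mtopology"
    and sets_borel: "sets \<mu> = sigma_sets X {U. openin mtopology U}"
    and full_support: "openin mtopology U \<Longrightarrow> U \<noteq> {} \<Longrightarrow> measure \<mu> U > 0"

definition Lip1 :: "(real \<Rightarrow> real) set" where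
  "Lip1 = {p. 1-lipschitz_on UNIV p}"

text \<open>Pointwise convergence is taken along sequences: the topology of pointwise convergence
  is metrizable on \<open>Lip1\<close>.\<close>

definition monoidal :: "(real \<Rightarrow> real) set \<Rightarrow> bool" where
  "monoidal L \<longleftrightarrow> L \<subseteq> Lip1 \<and> id \<in> L \<and> (\<forall>p\<in>L. \<forall>q\<in>L. p \<circ> q \<in> L) \<and>
     (\<forall>p q. (\<forall>n::nat. p n \<in> L) \<and> (\<forall>x. (\<lambda>n. p n x) \<longlonglongrightarrow> q x) \<longrightarrow> q \<in> L)"

definition real_translations :: "(real \<Rightarrow> real) set" where
  "real_translations = {\<lambda>x. x + c | c. True}"

text \<open>The features are total functions, of which only the values on the carrier matter.\<close>

type_synonym 'a data_triple = "'a set \<times> ('a \<Rightarrow> real) set \<times> 'a measure"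

definition feature_dist :: "'a set \<Rightarrow> ('a \<Rightarrow> real) set \<Rightarrow> 'a \<Rightarrow> 'a \<Rightarrow> real" where
  "feature_dist X F x y = (if x \<in> X \<and> y \<in> X then SUP f\<in>F. \<bar>f x - f y\<bar> else 0)"

text \<open>Boundedness is required because the real supremum of an unbounded set is unspecified.\<close>

fun geometric_data_set :: "'a data_triple \<Rightarrow> bool" where
  "geometric_data_set (X, F, \<mu>) \<longleftrightarrow>
     F \<noteq> {} \<and> (\<forall>x\<in>X. \<forall>y\<in>X. bdd_above ((\<lambda>f. \<bar>f x - f y\<bar>) ` F)) \<and>
     mm_space X (feature_dist X F) \<mu>"

definition dist_data :: "'a set \<Rightarrow> ('a \<Rightarrow> 'a \<Rightarrow> real) \<Rightarrow> 'a measure \<Rightarrow> 'a data_triple" where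
  "dist_data X d \<mu> = (X, {\<lambda>x. d x y | y. y \<in> X}, \<mu>)"

definition monoidal_dist_data ::
    "(real \<Rightarrow> real) set \<Rightarrow> 'a set \<Rightarrow> ('a \<Rightarrow> 'a \<Rightarrow> real) \<Rightarrow> 'a measure \<Rightarrow> 'a data_triple" where
  "monoidal_dist_data L X d \<mu> = (X, {\<lambda>x. p (d x y) | p y. p \<in> L \<and> y \<in> X}, \<mu>)"

text \<open>Diameters are extended, since \<^const>\<open>diameter\<close> is unspecified on unbounded sets.\<close>

definition ediam :: "real set \<Rightarrow> ennreal" where
  "ediam I = (SUP (x, y)\<in>I \<times> I. ennreal (dist x y))"

definition part_diam :: "real measure \<Rightarrow> real \<Rightarrow> ennreal" where
  "part_diam N \<alpha> = (INF I\<in>{I \<in> sets borel. measure N I \<ge> \<alpha>}. ediam I)"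

text \<open>\<open>obs_diam D \<kappa>\<close> is the quantity written $\mathrm{ObsDiam}(D;-\kappa)$; on a geometric data
  set every feature is 1-Lipschitz, hence measurable, so \<^const>\<open>distr\<close> is the push-forward.\<close>

fun obs_diam :: "'a data_triple \<Rightarrow> real \<Rightarrow> ennreal" where
  "obs_diam (X, F, \<mu>) \<kappa> = (SUP f\<in>F. part_diam (distr \<mu> borel f) (1 - \<kappa>))"

context mm_space
begin

lemma space_eq: "space \<mu> = X"
proof -
  have "{U. openin mtopology U} \<subseteq> Pow X"
    using openin_subset by fastforce
  then have "sets \<mu> = sets (sigma X {U. openin mtopology U})"
    by (simp add: sets_borel)
  then have "space \<mu> = space (sigma X {U. openin mtopology U})"
    by (rule sets_eq_imp_space_eq)
  then show ?thesis
    using \<open>{U. openin mtopology U} \<subseteq> Pow X\<close> by simp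
qed

lemma geometric_data_set_general:
  assumes L: "L \<subseteq> Lip1" "id \<in> L"
  shows "geometric_data_set (monoidal_dist_data L X d \<mu>)"
proof -
  define F where "F = {\<lambda>x. p (d x y) | p y. p \<in> L \<and> y \<in> X}"
  obtain z where z: "z \<in> X"
    using not_empty space_eq by blast
  have le: "\<bar>f x - f y\<bar> \<le> d x y" if "x \<in> X" "y \<in> X" "f \<in> F" for f x y
  proof -
    from that(3) obtain p w where f: "f = (\<lambda>x. p (d x w))" "p \<in> L" "w \<in> X"
      by (auto simp: F_def)
    have "\<bar>p (d x w) - p (d y w)\<bar> \<le> \<bar>d x w - d y w\<bar>"
      using L(1) f(2) by (fastforce simp: Lip1_def lipschitz_on_def dist_real_def)
    moreover have "\<bar>d x w - d y w\<bar> \<le> d x y"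
      using triangle[of x y w] triangle[of y x w] commute[of x y] that f(3) by linarith
    ultimately show ?thesis using f(1) by simp
  qed
  have bdd: "bdd_above ((\<lambda>f. \<bar>f x - f y\<bar>) ` F)" if "x \<in> X" "y \<in> X" for x y
    using le that by (intro bdd_aboveI2[where M = "d x y"]) auto
  have inF: "(\<lambda>x. d x y) \<in> F" if "y \<in> X" for y
  proof -
    have "(\<lambda>x. d x y) = (\<lambda>x. id (d x y))" by simp
    then show ?thesis unfolding F_def using that L(2) by blast
  qed
  have ne: "F \<noteq> {}" using inF z by auto
  have eq: "feature_dist X F x y = d x y" if "x \<in> X" "y \<in> X" for x y
  proof -
    have "(SUP f\<in>F. \<bar>f x - f y\<bar>) \<le> d x y"
      using le that ne by (intro cSUP_least) auto
    moreover have "d x y \<le> (SUP f\<in>F. \<bar>f x - f y\<bar>)"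
      using cSUP_upper[OF inF[OF that(2)] bdd[OF that]] that by simp
    ultimately show ?thesis using that by (simp add: feature_dist_def)
  qed
  interpret G: Metric_space X "feature_dist X F"
  proof
    show "0 \<le> feature_dist X F x y" for x y
      using eq[of x y] by (cases "x \<in> X \<and> y \<in> X") (auto simp: feature_dist_def)
    show "feature_dist X F x y = feature_dist X F y x" for x y
      by (simp add: feature_dist_def abs_minus_commute)
    show "feature_dist X F x y = 0 \<longleftrightarrow> x = y" if "x \<in> X" "y \<in> X" for x y
      using eq that by simp
    show "feature_dist X F x w \<le> feature_dist X F x y + feature_dist X F y w"
      if "x \<in> X" "y \<in> X" "w \<in> X" for x y w
      using eq that triangle by simp
  qed
  have ball: "G.mball x r = mball x r" for x r
    using eq by (auto simp: G.mball_def mball_def)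
  have top: "G.mtopology = mtopology"
    by (simp add: topology_eq G.openin_mtopology openin_mtopology ball)
  have compl: "G.mcomplete"
  proof -
    have "MCauchy \<sigma>" if "G.MCauchy \<sigma>" for \<sigma>
    proof -
      have "range \<sigma> \<subseteq> X" using that by (simp add: G.MCauchy_def)
      then have "feature_dist X F (\<sigma> i) (\<sigma> j) = d (\<sigma> i) (\<sigma> j)" for i j
        by (intro eq) auto
      then show ?thesis using that by (simp add: G.MCauchy_def MCauchy_def)
    qed
    then show ?thesis using complete by (simp add: G.mcomplete_def mcomplete_def top)
  qed
  have "mm_space X (feature_dist X F) \<mu>"
    using compl separable sets_borel full_support
    by unfold_locales (simp_all add: top)
  then show ?thesis
    unfolding monoidal_dist_data_def F_def[symmetric] using ne bdd by simp
qed

lemma geometric_data_set_monoidal_dist_data: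
  "monoidal L \<Longrightarrow> geometric_data_set (monoidal_dist_data L X d \<mu>)"
  by (rule geometric_data_set_general) (auto simp: monoidal_def)

lemma geometric_data_set_dist_data: "geometric_data_set (dist_data X d \<mu>)"
proof -
  have "dist_data X d \<mu> = monoidal_dist_data {id} X d \<mu>"
    by (simp add: dist_data_def monoidal_dist_data_def)
  then show ?thesis
    using geometric_data_set_general[of "{id}"] by (simp add: Lip1_def lipschitz_on_def)
qed

end

lemma geometric_data_set_feature_measurable:
  assumes "geometric_data_set (X, F, \<mu>)" "f \<in> F"
  shows "f \<in> borel_measurable \<mu>"
proof -
  interpret mm_space X "feature_dist X F" \<mu> using assms(1) by simp
  have le: "\<bar>f x - f y\<bar> \<le> feature_dist X F x y" if "x \<in> X" "y \<in> X" for x y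
  proof -
    have "bdd_above ((\<lambda>f. \<bar>f x - f y\<bar>) ` F)"
      using assms(1) that by simp
    from cSUP_upper[OF assms(2) this] show ?thesis
      using that by (simp add: feature_dist_def)
  qed
  show ?thesis
  proof (rule borel_measurableI)
    fix S :: "real set" assume S: "open S"
    have "openin mtopology (f -` S \<inter> X)"
      unfolding openin_mtopology
    proof (intro conjI allI impI)
      fix x assume x: "x \<in> f -` S \<inter> X"
      then obtain e where e: "e > 0" "ball (f x) e \<subseteq> S"
        using openE[OF S, of "f x"] by auto
      have "mball x e \<subseteq> f -` S \<inter> X"
      proof
        fix y assume "y \<in> mball x e"
        then have y: "x \<in> X" "y \<in> X" "feature_dist X F x y < e"
          by (simp_all only: in_mball)
        have "y \<in> X" "f y \<in> ball (f x) e"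
          using y le[of x y] by (simp_all add: dist_real_def)
        then show "y \<in> f -` S \<inter> X" using e(2) by blast
      qed
      then show "\<exists>r>0. mball x r \<subseteq> f -` S \<inter> X" using e(1) by blast
    qed simp
    then show "f -` S \<inter> space \<mu> \<in> sets \<mu>"
      unfolding space_eq sets_borel by (intro sigma_sets.Basic CollectI)
  qed
qed

end

(* Composing with a 1-Lipschitz map p cannot increase the partial diameter of a law on the
   line: an almost full set I is carried to the almost full set p(I), whose diameter is no
   larger. Since p(I) need not be Borel, it is replaced by its closure, of the same diameter.
   So the features p(d(x, -)) contribute no more to the supremum than the features d(x, -),
   which are themselves among them because id belongs to L. *)
theory Submission
  imports Defs
begin

lemma ediam_mono: "A \<subseteq> B \<Longrightarrow> ediam A \<le> ediam B"
  unfolding ediam_def by (intro SUP_subset_mono) auto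

lemma dist_le_ediam: "x \<in> A \<Longrightarrow> y \<in> A \<Longrightarrow> ennreal (dist x y) \<le> ediam A"
  unfolding ediam_def by (rule SUP_upper2[where i = "(x, y)"]) auto

lemma ediam_le_iff: "ediam A \<le> c \<longleftrightarrow> (\<forall>x\<in>A. \<forall>y\<in>A. ennreal (dist x y) \<le> c)"
  unfolding ediam_def by (auto simp: SUP_le_iff)

text \<open>The pairs at distance at most \<open>ediam A\<close> form a closed subset of the plane
  containing \<open>A \<times> A\<close>. It therefore contains the closure of
  \<open>A \<times> A\<close>, which is \<open>closure A \<times> closure A\<close>.\<close>

lemma ediam_closure [simp]: "ediam (closure A) = ediam A"
proof (rule antisym)
  let ?C = "{z. ennreal (dist (fst z) (snd z)) \<le> ediam A}"
  have "closed ?C"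
    by (intro closed_Collect_le continuous_on_ennreal continuous_intros)
  moreover have "A \<times> A \<subseteq> ?C"
    by (auto intro: dist_le_ediam)
  ultimately have "closure (A \<times> A) \<subseteq> ?C"
    by (rule closure_minimal[rotated])
  then show "ediam (closure A) \<le> ediam A"
    by (auto simp: ediam_le_iff closure_Times)
  show "ediam A \<le> ediam (closure A)"
    by (intro ediam_mono closure_subset)
qed

lemma ediam_lipschitz_image_le:
  assumes "1-lipschitz_on A p"
  shows "ediam (p ` A) \<le> ediam A"
proof -
  have "ennreal (dist (p x) (p y)) \<le> ediam A" if "x \<in> A" "y \<in> A" for x y
  proof -
    have "dist (p x) (p y) \<le> dist x y"
      using lipschitz_onD[OF assms that] by simp
    then show ?thesis
      using dist_le_ediam[OF that] by (meson ennreal_leI order_trans)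
  qed
  then show ?thesis by (auto simp: ediam_le_iff)
qed

text \<open>The infima are compared by matching each set competing for \<open>N\<close> with one
  competing for the push-forward. Finiteness of \<open>N\<close> makes the real-valued
  \<open>measure\<close> monotone; it would send infinite mass to 0.\<close>

lemma part_diam_distr_lipschitz_le:
  assumes N: "finite_measure N" "sets N = sets borel"
    and p: "1-lipschitz_on UNIV p"
  shows "part_diam (distr N borel p) \<alpha> \<le> part_diam N \<alpha>"
  unfolding part_diam_def
proof (rule INF_mono)
  fix I :: "real set" assume I: "I \<in> {I \<in> sets borel. measure N I \<ge> \<alpha>}"
  interpret finite_measure N by (rule N(1))
  have space: "space N = UNIV"
    using sets_eq_imp_space_eq[OF N(2)] by simp
  have meas: "p \<in> measurable N borel"
    using borel_measurable_continuous_onI[OF lipschitz_on_continuous_on[OF p]] N(2)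
    by (simp cong: measurable_cong_sets)
  let ?J = "closure (p ` I)"
  \<comment> \<open>The preimage may be strictly larger than \<open>I\<close>, which only helps the
    lower bound on the mass.\<close>
  have "I \<subseteq> p -` ?J"
    using closure_subset by fastforce
  moreover have "p -` ?J \<in> sets N"
    using measurable_sets[OF meas, of ?J] by (simp add: space)
  ultimately have "measure N I \<le> measure N (p -` ?J)"
    by (rule finite_measure_mono)
  also have "\<dots> = measure (distr N borel p) ?J"
    using measure_distr[OF meas, of ?J] by (simp add: space)
  finally have "\<alpha> \<le> measure (distr N borel p) ?J"
    using I by simp
  moreover have "ediam ?J \<le> ediam I"
    using ediam_lipschitz_image_le[OF lipschitz_on_subset[OF p]] by simp
  ultimately show "\<exists>J\<in>{I \<in> sets borel. measure (distr N borel p) I \<ge> \<alpha>}. ediam J \<le> ediam I"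
    by (intro bexI[of _ ?J]) auto
qed

theorem proposition8p2:
  fixes L :: "(real \<Rightarrow> real) set"
    and X :: "'a set" and d :: "'a \<Rightarrow> 'a \<Rightarrow> real" and \<mu> :: "'a measure"
    and \<kappa> :: real
  assumes "monoidal L" and "real_translations \<subseteq> L"
    and "mm_space X d \<mu>"
    and "0 < \<kappa>" and "\<kappa> < 1"
  shows "obs_diam (monoidal_dist_data L X d \<mu>) \<kappa> = obs_diam (dist_data X d \<mu>) \<kappa>"
proof -
  interpret mm_space X d \<mu> by fact
  define F where "F = {\<lambda>x. d x y | y. y \<in> X}"
  define G where "G = {\<lambda>x. p (d x y) | p y. p \<in> L \<and> y \<in> X}"
  have L: "L \<subseteq> Lip1" "id \<in> L"
    using assms(1) by (auto simp: monoidal_def)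
  \<comment> \<open>This yields Borel measurability of the distance functions, on which the
    composition rule for push-forwards below relies.\<close>
  have "geometric_data_set (X, F, \<mu>)"
    using geometric_data_set_dist_data by (simp add: dist_data_def F_def)
  then have meas: "f \<in> borel_measurable \<mu>" if "f \<in> F" for f
    using that by (rule geometric_data_set_feature_measurable)
  have "F \<subseteq> G"
  proof
    fix f assume "f \<in> F"
    then obtain y where "y \<in> X" "f = (\<lambda>x. id (d x y))" by (auto simp: F_def)
    then show "f \<in> G" unfolding G_def using L(2) by blast
  qed
  \<comment> \<open>The dominating feature is the distance function with the same centre
    \<open>y\<close>, obtained by dropping \<open>p\<close>.\<close>
  moreover have "\<exists>f\<in>F. part_diam (distr \<mu> borel g) (1 - \<kappa>) \<le> part_diam (distr \<mu> borel f) (1 - \<kappa>)"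
    if "g \<in> G" for g
  proof -
    obtain p y where g: "g = p \<circ> (\<lambda>x. d x y)" "p \<in> L" "y \<in> X"
      using \<open>g \<in> G\<close> by (auto simp: G_def o_def)
    let ?f = "\<lambda>x. d x y"
    have f: "?f \<in> F" using g(3) by (auto simp: F_def)
    have p: "1-lipschitz_on UNIV p" using g(2) L(1) by (auto simp: Lip1_def)
    have "p \<in> borel_measurable borel"
      by (intro borel_measurable_continuous_onI lipschitz_on_continuous_on[OF p])
    \<comment> \<open>The law of \<open>g\<close> is the image under \<open>p\<close> of a law on
      the line, so the comparison no longer involves \<open>X\<close>.\<close>
    then have "distr \<mu> borel g = distr (distr \<mu> borel ?f) borel p"
      using meas[OF f] by (simp add: g(1) distr_distr)
    moreover have "finite_measure (distr \<mu> borel ?f)"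
      using meas[OF f] by (rule finite_measure_distr)
    ultimately have "part_diam (distr \<mu> borel g) (1 - \<kappa>) \<le> part_diam (distr \<mu> borel ?f) (1 - \<kappa>)"
      using part_diam_distr_lipschitz_le[OF _ _ p] by simp
    then show ?thesis using f by blast
  qed
  ultimately have "(SUP g\<in>G. part_diam (distr \<mu> borel g) (1 - \<kappa>)) =
      (SUP f\<in>F. part_diam (distr \<mu> borel f) (1 - \<kappa>))"
    by (intro antisym SUP_mono SUP_subset_mono) auto
  then show ?thesis
    by (simp add: monoidal_dist_data_def dist_data_def F_def G_def)
qed

end
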